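(* Let $X$ be a Hausdorff zero-dimensional topological space and let $F$ be a totally ordered field (with its order topology) that is either uncountable or a countable subfield of $\mathbb{R}$. Then the structure space $\mathcal{M}_c(X,F)$ of the ring $C_c(X,F)$ is zero-dimensional, and hence $\mathcal{M}_c(X,F)=\beta_0X$; that is, the compactification $(\psi,\mathcal{M}_c(X,F))$ of $X$, where $\psi(p)=\{f\in C_c(X,F): f(p)=0\}$ for $p\in X$, is topologically equivalent to the Banaschewski compactification $\beta_0X$ of $X$.
   Context: A totally ordered field $F$ carries its order (interval) topology. $C_c(X,F)$ is the commutative ring with unity (pointwise operations) of all continuous functions $f:X\to F$ whose range $f(X)$ is countable. A space is zero-dimensional if it has a base of clopen sets. The structure space of a commutative ring $A$ with unity is the set $\mathcal{M}(A)$ of all maximal ideals of $A$ with the hull-kernel topology, in which the sets $\mathcal{M}_a=\{M\in\mathcal{M}(A): a\in M\}$, $a\in A$, form a base for the closed sets; $\mathcal{M}_c(X,F)$ denotes the structure space of $C_c(X,F)$. The Banaschewski compactification $\beta_0X$ of a Hausdorff zero-dimensional space $X$ is the (unique up to equivalence of compactifications) zero-dimensional Hausdorff compactification of $X$ such that every continuous map from $X$ to a compact Hausdorff zero-dimensional space $Y$ extends to a continuous map $\beta_0X\to Y$. Two compactifications of $X$ are topologically equivalent if there is a homeomorphism between them commuting with the embeddings of $X$. *)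

theory Defs
  imports "HOL-Analysis.Analysis" "HOL-Algebra.Ideal"
begin

section \<open>Zero-dimensional spaces and compactifications\<close>

definition zero_dimensional_space :: "'a topology \<Rightarrow> bool" where
  "zero_dimensional_space X \<longleftrightarrow>
     (\<exists>B. (\<forall>U\<in>B. openin X U \<and> closedin X U) \<and>
          (\<forall>U x. openin X U \<and> x \<in> U \<longrightarrow> (\<exists>V\<in>B. x \<in> V \<and> V \<subseteq> U)))"

definition compactification :: "'a topology \<Rightarrow> ('a \<Rightarrow> 'k) \<Rightarrow> 'k topology \<Rightarrow> bool" where
  "compactification X e K \<longleftrightarrow>
     compact_space K \<and> Hausdorff_space K \<and> embedding_map X K e \<and>
     K closure_of (e ` topspace X) = topspace K"

definition compactification_equivalent ::
    "'a topology \<Rightarrow> ('a \<Rightarrow> 'k) \<Rightarrow> 'k topology \<Rightarrow> ('a \<Rightarrow> 'l) \<Rightarrow> 'l topology \<Rightarrow> bool" where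
  "compactification_equivalent X e K d L \<longleftrightarrow>
     (\<exists>h. homeomorphic_map K L h \<and> (\<forall>x\<in>topspace X. h (e x) = d x))"

text \<open>
  The extension property of the Banaschewski compactification quantifies over all compact
  Hausdorff zero-dimensional spaces. HOL cannot quantify over types inside a formula, so the type
  of the points of the test spaces is the parameter \<open>TYPE('y)\<close>; the unrestricted property is
  obtained by leaving \<open>'y\<close> free in the conclusion of a theorem. As a hypothesis, the property for one
  particular \<open>'y\<close> is implied by the unrestricted one.
\<close>

definition banaschewski_compactification ::
    "'y itself \<Rightarrow> 'a topology \<Rightarrow> ('a \<Rightarrow> 'k) \<Rightarrow> 'k topology \<Rightarrow> bool" where
  "banaschewski_compactification (_ :: 'y itself) X e K \<longleftrightarrow>
     compactification X e K \<and> zero_dimensional_space K \<and>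
     (\<forall>(Y :: 'y topology) f.
        compact_space Y \<and> Hausdorff_space Y \<and> zero_dimensional_space Y \<and> continuous_map X Y f \<longrightarrow>
        (\<exists>g. continuous_map K Y g \<and> (\<forall>x\<in>topspace X. g (e x) = f x)))"

section \<open>The structure space of a commutative ring\<close>

definition maximal_ideals :: "('r, 'm) ring_scheme \<Rightarrow> 'r set set" where
  "maximal_ideals R = {M. maximalideal M R}"

definition maximal_ideals_at :: "('r, 'm) ring_scheme \<Rightarrow> 'r \<Rightarrow> 'r set set" where
  "maximal_ideals_at R a = {M \<in> maximal_ideals R. a \<in> M}"

definition structure_space :: "('r, 'm) ring_scheme \<Rightarrow> 'r set topology" where
  "structure_space R =
     topology (arbitrary union_of
       (\<lambda>U. \<exists>a\<in>carrier R. U = maximal_ideals R - maximal_ideals_at R a))"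

text \<open>
  The function \<^const>\<open>topology\<close> is meaningful only on families that form a topology; this holds
  here because maximal ideals are prime.
\<close>

lemma (in cring) maximal_ideals_at_mult:
  assumes "a \<in> carrier R" "b \<in> carrier R"
  shows "maximal_ideals_at R (a \<otimes> b) = maximal_ideals_at R a \<union> maximal_ideals_at R b"
proof -
  have "a \<otimes> b \<in> M \<longleftrightarrow> a \<in> M \<or> b \<in> M" if "maximalideal M R" for M
  proof -
    interpret primeideal M R using maximalideal_prime[OF that] .
    show ?thesis using assms I_prime[of a b] I_l_closed[of b a] I_r_closed[of a b] by auto
  qed
  then show ?thesis
    by (auto simp: maximal_ideals_at_def maximal_ideals_def)
qed

lemma (in cring) openin_structure_space:
  "openin (structure_space R) =
     arbitrary union_of (\<lambda>U. \<exists>a\<in>carrier R. U = maximal_ideals R - maximal_ideals_at R a)"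
  unfolding structure_space_def
proof (rule topology_inverse', rule istopology_base)
  fix S T
  assume "\<exists>a\<in>carrier R. S = maximal_ideals R - maximal_ideals_at R a"
    and "\<exists>a\<in>carrier R. T = maximal_ideals R - maximal_ideals_at R a"
  then obtain a b where "a \<in> carrier R" "b \<in> carrier R"
    "S = maximal_ideals R - maximal_ideals_at R a" "T = maximal_ideals R - maximal_ideals_at R b"
    by blast
  then show "\<exists>a\<in>carrier R. S \<inter> T = maximal_ideals R - maximal_ideals_at R a"
    by (intro bexI[of _ "a \<otimes> b"]) (auto simp: maximal_ideals_at_mult)
qed

lemma (in cring) topspace_structure_space: "topspace (structure_space R) = maximal_ideals R"
proof
  have "\<one> \<notin> M" if "maximalideal M R" for M
  proof -
    interpret maximalideal M R by (rule that)
    show ?thesis using one_imp_carrier I_notcarr by auto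
  qed
  then have "maximal_ideals R = maximal_ideals R - maximal_ideals_at R \<one>"
    by (auto simp: maximal_ideals_at_def maximal_ideals_def)
  then have "\<exists>a\<in>carrier R. maximal_ideals R = maximal_ideals R - maximal_ideals_at R a"
    by (rule bexI[OF _ one_closed])
  then have "openin (structure_space R) (maximal_ideals R)"
    unfolding openin_structure_space by (rule arbitrary_union_of_inc)
  then show "maximal_ideals R \<subseteq> topspace (structure_space R)"
    by (rule openin_subset)
  have "S \<subseteq> maximal_ideals R" if "openin (structure_space R) S" for S
    using that unfolding openin_structure_space by (force simp: union_of_def)
  then show "topspace (structure_space R) \<subseteq> maximal_ideals R"
    by simp
qed

section \<open>Rings of continuous functions with countable range\<close>

text \<open>
  The order topology on \<open>'f\<close> is provided by the class \<^class>\<open>linorder_topology\<close>. Functions on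
  the space are represented by functions that are \<^const>\<open>extensional\<close> on its point set.
\<close>

definition countable_range_ring ::
    "'a topology \<Rightarrow> ('a \<Rightarrow> 'f::{linordered_field, linorder_topology}) ring" where
  "countable_range_ring X =
     \<lparr>carrier = {f \<in> extensional (topspace X).
                   continuous_map X euclidean f \<and> countable (f ` topspace X)},
      mult = (\<lambda>f g. \<lambda>x\<in>topspace X. f x * g x),
      one = (\<lambda>x\<in>topspace X. 1),
      zero = (\<lambda>x\<in>topspace X. 0),
      add = (\<lambda>f g. \<lambda>x\<in>topspace X. f x + g x)\<rparr>"

definition vanishing_ideal ::
    "'a topology \<Rightarrow> 'a \<Rightarrow> ('a \<Rightarrow> 'f::{linordered_field, linorder_topology}) set" where
  "vanishing_ideal X p = {f \<in> carrier (countable_range_ring X). f p = 0}"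

text \<open>A subfield of the reals carries the order of the reals.\<close>

definition ordered_subfield_of_reals :: "'f::linordered_field itself \<Rightarrow> bool" where
  "ordered_subfield_of_reals (_ :: 'f itself) \<longleftrightarrow>
     (\<exists>h :: 'f \<Rightarrow> real. h 1 = 1 \<and> (\<forall>x y. h (x + y) = h x + h y) \<and>
        (\<forall>x y. h (x * y) = h x * h y) \<and> strict_mono h)"

end

theory Submission
  imports Defs "HOL-Algebra.Ring_Divisibility"
begin

text \<open>
  The ring \<open>A = C\<^sub>c(X, F)\<close> has enough idempotents. The range of \<open>k \<in> A\<close> is countable, so some cut
  of \<open>F\<close> strictly between \<open>0\<close> and \<open>1\<close> misses it: a point of \<open>F\<close> if \<open>F\<close> is uncountable, an
  irrational cut if \<open>F\<close> is a countable subfield of the reals. The set \<open>E\<close> of points where \<open>k\<close> lies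
  above the cut is clopen, \<open>k\<close> is invertible on \<open>E\<close> and \<open>1 - k\<close> is invertible off \<open>E\<close>. Hence the
  indicator of \<open>E\<close> is a multiple of \<open>k\<close> and its complement is a multiple of \<open>1 - k\<close>
  (\<open>exchange_ring_countable_range_ring\<close>).

  For any commutative ring with this exchange property the structure space is zero-dimensional and
  Hausdorff (\<open>exchange_ring_zero_dimensional\<close>, \<open>exchange_ring_Hausdorff\<close>). If \<open>f \<notin> M\<close>, then
  \<open>f g + m = 1\<close> for some \<open>m \<in> M\<close>; exchanging this pair for complementary idempotents
  \<open>e \<in> f A\<close> and \<open>1 - e \<in> m A \<subseteq> M\<close>, the maximal ideals that miss \<open>e\<close> form a clopen set which
  contains \<open>M\<close> and lies in the basic open set of \<open>f\<close>. Compactness holds for every commutative ring,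
  because a proper ideal lies in a maximal one and membership in a generated ideal involves only
  finitely many generators (\<open>compact_space_structure_space\<close>).

  Indicators of clopen sets of \<open>X\<close> show that \<open>\<psi>\<close> is an embedding, and its image is dense because only
  the zero function vanishes everywhere. For the extension property, a maximal ideal \<open>M\<close> turns a
  continuous \<open>f : X \<rightarrow> Y\<close> into the ultrafilter of those clopen \<open>V \<subseteq> Y\<close> for which the indicator of the
  preimage of \<open>V\<close> is not in \<open>M\<close>; if \<open>Y\<close> is compact, Hausdorff and zero-dimensional, this ultrafilter
  converges to a point, which is the value of the extension at \<open>M\<close>
  (\<open>structure_space_extension\<close>). The equivalence with any other Banaschewski compactification is the
  usual uniqueness of an object with a universal property, since maps to a Hausdorff space are
  determined on a dense set (\<open>banaschewski_compactification_unique\<close>).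
\<close>

section \<open>Zero-dimensional spaces and uniqueness of compactifications\<close>

lemma zero_dimensional_space_clopen_neighbourhood:
  assumes "zero_dimensional_space X" "openin X U" "x \<in> U"
  obtains V where "openin X V" "closedin X V" "x \<in> V" "V \<subseteq> U"
proof -
  obtain B where "\<forall>V\<in>B. openin X V \<and> closedin X V" "\<exists>V\<in>B. x \<in> V \<and> V \<subseteq> U"
    using assms unfolding zero_dimensional_space_def by blast
  with that show thesis
    by blast
qed

lemma zero_dimensional_T0_imp_Hausdorff:
  assumes zd: "zero_dimensional_space X"
    and T0: "\<And>x y. \<lbrakk>x \<in> topspace X; y \<in> topspace X; x \<noteq> y\<rbrakk> \<Longrightarrow> \<exists>U. openin X U \<and> x \<in> U \<and> y \<notin> U"
  shows "Hausdorff_space X"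
  unfolding Hausdorff_space_def
proof (intro allI impI)
  fix x y
  assume xy: "x \<in> topspace X \<and> y \<in> topspace X \<and> x \<noteq> y"
  then obtain U where "openin X U" "x \<in> U" "y \<notin> U"
    using T0 by blast
  then obtain V where V: "openin X V" "closedin X V" "x \<in> V" "V \<subseteq> U"
    using zero_dimensional_space_clopen_neighbourhood[OF zd] by metis
  then have "openin X (topspace X - V)" "y \<in> topspace X - V" "disjnt V (topspace X - V)"
    using xy \<open>y \<notin> U\<close> by (auto simp: disjnt_def)
  then show "\<exists>U V. openin X U \<and> openin X V \<and> x \<in> U \<and> y \<in> V \<and> disjnt U V"
    using V by blast
qed

text \<open>
  A self-map of a compactification is determined by its values on the dense image of the space,
  because the set where it agrees with the identity is closed.
\<close>
lemma compactification_retraction_identity: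
  assumes K: "compactification X e K"
    and u: "continuous_map K K u" and ue: "\<And>x. x \<in> topspace X \<Longrightarrow> u (e x) = e x"
    and y: "y \<in> topspace K"
  shows "u y = y"
proof -
  have "Hausdorff_space K" "K closure_of (e ` topspace X) = topspace K"
    using K by (auto simp: compactification_def)
  then show ?thesis
    using forall_in_closure_of_eq[of y K "e ` topspace X" K u id] u ue y by auto
qed

lemma compactification_equivalentI:
  assumes K: "compactification X e K" and L: "compactification X d L"
    and g: "continuous_map K L g" "\<And>x. x \<in> topspace X \<Longrightarrow> g (e x) = d x"
    and h: "continuous_map L K h" "\<And>x. x \<in> topspace X \<Longrightarrow> h (d x) = e x"
  shows "compactification_equivalent X e K d L"
proof -
  have "(h \<circ> g) y = y" if "y \<in> topspace K" for y
    by (rule compactification_retraction_identity[OF K continuous_map_compose[OF g(1) h(1)]])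
      (auto simp: g h that)
  moreover have "(g \<circ> h) y = y" if "y \<in> topspace L" for y
    by (rule compactification_retraction_identity[OF L continuous_map_compose[OF h(1) g(1)]])
      (auto simp: g h that)
  ultimately have "homeomorphic_maps K L g h"
    using g h by (auto simp: homeomorphic_maps_def)
  then show ?thesis
    unfolding compactification_equivalent_def using homeomorphic_map_maps g(2) by blast
qed

section \<open>The structure space of a commutative ring\<close>

abbreviation maximal_ideals_off :: "('r, 'm) ring_scheme \<Rightarrow> 'r \<Rightarrow> 'r set set" where
  "maximal_ideals_off R a \<equiv> maximal_ideals R - maximal_ideals_at R a"

text \<open>Closure under negation comes for free, since \<open>- a = (- 1) a\<close>.\<close>
lemma (in cring) ideal_by_absorption:
  assumes "I \<subseteq> carrier R" "\<zero> \<in> I"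
    and add: "\<And>a b. \<lbrakk>a \<in> I; b \<in> I\<rbrakk> \<Longrightarrow> a \<oplus> b \<in> I"
    and mult: "\<And>a x. \<lbrakk>a \<in> I; x \<in> carrier R\<rbrakk> \<Longrightarrow> x \<otimes> a \<in> I"
  shows "ideal I R"
proof (rule idealI[OF ring_axioms])
  show "subgroup I (add_monoid R)"
  proof (rule add.subgroupI)
    fix a
    assume a: "a \<in> I"
    then have "\<ominus> a = (\<ominus> \<one>) \<otimes> a"
      using assms(1) by (simp add: l_minus subset_iff)
    with mult[OF a, of "\<ominus> \<one>"] show "\<ominus> a \<in> I"
      by simp
  qed (use assms in auto)
next
  fix a x
  assume a: "a \<in> I" and x: "x \<in> carrier R"
  then show "x \<otimes> a \<in> I"
    by (rule mult)
  then show "a \<otimes> x \<in> I"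
    using m_comm[of a x] a x assms(1) by auto
qed

lemma (in ring) maximalideal_proper: 
  assumes "maximalideal M R"
  shows "\<one> \<notin> M"
proof -
  interpret maximalideal M R by (rule assms)
  show ?thesis
    using one_imp_carrier I_notcarr by auto
qed

lemma (in cring) maximalideal_contains_ideal:
  assumes I: "ideal I R" and one: "\<one> \<notin> I"
  obtains M where "maximalideal M R" "I \<subseteq> M"
proof -
  define \<A> where "\<A> = {J. ideal J R \<and> I \<subseteq> J \<and> \<one> \<notin> J}"
  have "\<exists>M\<in>\<A>. \<forall>J\<in>\<A>. M \<subseteq> J \<longrightarrow> J = M"
  proof (rule subset_Zorn_nonempty)
    show "\<A> \<noteq> {}"
      using assms by (auto simp: \<A>_def)
    fix \<C>
    assume ne: "\<C> \<noteq> {}" and chain: "subset.chain \<A> \<C>"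
    then have "subset.chain {J. ideal J R} \<C>"
      by (auto simp: subset_chain_def \<A>_def)
    from chain_Union_is_ideal[OF this] ne have "ideal (\<Union>\<C>) R"
      by simp
    moreover have "\<C> \<subseteq> \<A>"
      using chain by (simp add: subset_chain_def)
    ultimately show "\<Union>\<C> \<in> \<A>"
      using ne unfolding \<A>_def by blast
  qed
  then obtain M where M\<A>: "M \<in> \<A>" and max: "\<And>J. \<lbrakk>J \<in> \<A>; M \<subseteq> J\<rbrakk> \<Longrightarrow> J = M"
    by blast
  have M: "ideal M R" "I \<subseteq> M" "\<one> \<notin> M"
    using M\<A> by (simp_all add: \<A>_def)
  have "maximalideal M R"
  proof (rule maximalidealI[OF M(1)])
    show "carrier R \<noteq> M"
      using one_closed M(3) by metis
    show "J = M \<or> J = carrier R" if "ideal J R" "M \<subseteq> J" "J \<subseteq> carrier R" for J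
    proof (cases "\<one> \<in> J")
      case True
      then show ?thesis
        using ideal.one_imp_carrier[OF that(1)] by simp
    next
      case False
      then show ?thesis
        using max[of J] that(1,2) M(2) by (simp add: \<A>_def)
    qed
  qed
  with M that show thesis
    by blast
qed

text \<open>
  The ideals generated by the finite subsets of \<open>A\<close> are directed, so their union is an ideal; it
  contains \<open>A\<close> and therefore everything that \<open>A\<close> generates.
\<close>
lemma (in cring) genideal_finitary:
  assumes A: "A \<subseteq> carrier R" and x: "x \<in> Idl A"
  obtains B where "finite B" "B \<subseteq> A" "x \<in> Idl B"
proof -
  define J where "J = (\<Union>B\<in>{B. finite B \<and> B \<subseteq> A}. Idl B)"
  have ideal: "ideal (Idl B) R" if "B \<subseteq> A" for B
    using that A by (intro genideal_ideal) auto
  have J: "ideal J R"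
  proof (rule ideal_by_absorption)
    show "J \<subseteq> carrier R"
      using ideal.Icarr[OF ideal] by (auto simp: J_def)
    have "\<zero> \<in> Idl {}"
      using ideal[of "{}"] by (simp add: additive_subgroup.zero_closed ideal.axioms(1))
    then show "\<zero> \<in> J"
      unfolding J_def by blast
  next
    fix a b
    assume "a \<in> J" "b \<in> J"
    then obtain B C where B: "finite B" "B \<subseteq> A" "a \<in> Idl B" and C: "finite C" "C \<subseteq> A" "b \<in> Idl C"
      unfolding J_def by blast
    have "Idl B \<subseteq> Idl (B \<union> C)" "Idl C \<subseteq> Idl (B \<union> C)"
      using A B C by (intro subset_Idl_subset; blast)+
    then have "a \<oplus> b \<in> Idl (B \<union> C)"
      using B C additive_subgroup.a_closed[OF ideal.axioms(1)[OF ideal[of "B \<union> C"]]] by blast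
    then show "a \<oplus> b \<in> J"
      unfolding J_def using B C by blast
  next
    fix a y
    assume "a \<in> J" "y \<in> carrier R"
    then show "y \<otimes> a \<in> J"
      unfolding J_def using ideal.I_l_closed[OF ideal] by blast
  qed
  moreover have "A \<subseteq> J"
  proof
    fix a
    assume "a \<in> A"
    then have "{a} \<subseteq> A" "a \<in> Idl {a}"
      using A genideal_self' by auto
    then show "a \<in> J"
      unfolding J_def by blast
  qed
  ultimately have "x \<in> J"
    using genideal_minimal[OF J] x by blast
  with that show thesis
    unfolding J_def by blast
qed

lemma (in cring) openin_maximal_ideals_off:
  "a \<in> carrier R \<Longrightarrow> openin (structure_space R) (maximal_ideals_off R a)"
  unfolding openin_structure_space by (rule arbitrary_union_of_inc) blast

lemma (in cring) structure_space_neighbourhood: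
  assumes "openin (structure_space R) U" "M \<in> U"
  obtains a where "a \<in> carrier R" "a \<notin> M" "maximal_ideals_off R a \<subseteq> U"
proof -
  have "\<exists>V. (\<exists>a\<in>carrier R. V = maximal_ideals_off R a) \<and> M \<in> V \<and> V \<subseteq> U"
    using assms openin_structure_space unfolding openin_topology_base_unique by blast
  then show thesis
    using that by (auto simp: maximal_ideals_at_def)
qed

text \<open>
  Given an open cover, let \<open>A\<close> consist of the ring elements whose basic open set lies in a member of the
  cover. No maximal ideal contains \<open>A\<close>, so \<open>A\<close> generates the unit ideal. Finitely many elements of
  \<open>A\<close> already do, and the corresponding members cover the space.
\<close>
lemma (in cring) compact_space_structure_space: "compact_space (structure_space R)"
  unfolding compact_space topspace_structure_space
proof (intro allI impI)
  fix \<U>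
  assume asm: "(\<forall>U\<in>\<U>. openin (structure_space R) U) \<and> \<Union>\<U> = maximal_ideals R"
  define A where "A = {a \<in> carrier R. \<exists>U\<in>\<U>. maximal_ideals_off R a \<subseteq> U}"
  have A: "A \<subseteq> carrier R"
    by (auto simp: A_def)
  have "\<one> \<in> Idl A"
  proof (rule ccontr)
    assume "\<one> \<notin> Idl A"
    then obtain M where M: "maximalideal M R" "Idl A \<subseteq> M"
      using maximalideal_contains_ideal genideal_ideal[OF A] by metis
    then have "M \<in> \<Union>\<U>"
      using asm by (simp add: maximal_ideals_def)
    then obtain U where U: "U \<in> \<U>" "M \<in> U"
      by blast
    then have "openin (structure_space R) U"
      using asm by blast
    from structure_space_neighbourhood[OF this U(2)]
    obtain a where "a \<in> carrier R" "a \<notin> M" "maximal_ideals_off R a \<subseteq> U" .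
    then show False
      using U M genideal_self[OF A] by (auto simp: A_def)
  qed
  then obtain B where B: "finite B" "B \<subseteq> A" "\<one> \<in> Idl B"
    using genideal_finitary[OF A] by metis
  then have "\<forall>b\<in>B. \<exists>U. U \<in> \<U> \<and> maximal_ideals_off R b \<subseteq> U"
    by (auto simp: A_def)
  then obtain u where u: "\<And>b. b \<in> B \<Longrightarrow> u b \<in> \<U> \<and> maximal_ideals_off R b \<subseteq> u b"
    by metis
  have "M \<in> \<Union>(u ` B)" if M: "M \<in> maximal_ideals R" for M
  proof -
    have M': "maximalideal M R"
      using M by (simp add: maximal_ideals_def)
    have "\<not> B \<subseteq> M"
      using genideal_minimal[of M B] maximalideal_proper[OF M'] maximalideal.axioms(1)[OF M'] B
      by blast
    then obtain b where "b \<in> B" "b \<notin> M"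
      by blast
    then have "M \<in> u b"
      using u[of b] M by (auto simp: maximal_ideals_at_def)
    then show ?thesis
      using \<open>b \<in> B\<close> by blast
  qed
  then have "\<Union>(u ` B) = maximal_ideals R"
    using u asm by blast
  then show "\<exists>\<F>. finite \<F> \<and> \<F> \<subseteq> \<U> \<and> \<Union>\<F> = maximal_ideals R"
    using B u by (intro exI[of _ "u ` B"]) auto
qed

text \<open>Elements outside \<open>M\<close> are units modulo \<open>M\<close>, because \<open>f R + M\<close> is an ideal larger than \<open>M\<close>.\<close>
lemma (in cring) maximalideal_comaximal:
  assumes M: "maximalideal M R" and f: "f \<in> carrier R" "f \<notin> M"
  obtains g m where "g \<in> carrier R" "m \<in> M" "f \<otimes> g \<oplus> m = \<one>"
proof -
  have id: "ideal M R"
    using M by (rule maximalideal.axioms)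
  have Mc: "M \<subseteq> carrier R"
    using ideal.Icarr[OF id] by blast
  have J: "ideal (PIdl f <+> M) R"
    using add_ideals[OF cgenideal_ideal[OF f(1)] id] .
  have z: "\<zero> \<in> PIdl f" "\<zero> \<in> M"
    using cgenideal_ideal[OF f(1)] id by (simp_all add: additive_subgroup.zero_closed ideal.axioms(1))
  have "M \<subseteq> PIdl f <+> M"
  proof
    fix x
    assume x: "x \<in> M"
    then have "x = \<zero> \<oplus> x"
      using Mc by (simp add: subset_iff)
    with x z(1) show "x \<in> PIdl f <+> M"
      unfolding set_add_def' by blast
  qed
  moreover have "f \<in> PIdl f <+> M"
  proof -
    have "f = f \<oplus> \<zero>"
      using f(1) by simp
    with z(2) cgenideal_self[OF f(1)] show ?thesis
      unfolding set_add_def' by blast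
  qed
  moreover have "PIdl f <+> M \<subseteq> carrier R"
    using ideal.Icarr[OF J] by (rule subsetI)
  ultimately have "PIdl f <+> M = carrier R"
    using maximalideal.I_maximal[OF M J] f(2) by metis
  then have "\<one> \<in> PIdl f <+> M"
    by simp
  then obtain g m where g: "g \<in> carrier R" and m: "m \<in> M" and sum: "\<one> = g \<otimes> f \<oplus> m"
    unfolding set_add_def' cgenideal_def by blast
  have "f \<otimes> g \<oplus> m = \<one>"
    using sum m_comm[OF f(1) g] by simp
  with g m show thesis
    by (rule that)
qed

text \<open>
  This is the exchange property of Nicholson and Goodearl for commutative rings. The products
  \<open>k u\<close> and \<open>l v\<close> have sum one and product zero, so they are complementary idempotents.
\<close>
definition exchange_ring :: "('r, 'm) ring_scheme \<Rightarrow> bool" where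
  "exchange_ring R \<longleftrightarrow>
     (\<forall>k\<in>carrier R. \<forall>l\<in>carrier R. k \<oplus>\<^bsub>R\<^esub> l = \<one>\<^bsub>R\<^esub> \<longrightarrow>
        (\<exists>u\<in>carrier R. \<exists>v\<in>carrier R.
           (k \<otimes>\<^bsub>R\<^esub> u) \<oplus>\<^bsub>R\<^esub> (l \<otimes>\<^bsub>R\<^esub> v) = \<one>\<^bsub>R\<^esub> \<and>
           (k \<otimes>\<^bsub>R\<^esub> u) \<otimes>\<^bsub>R\<^esub> (l \<otimes>\<^bsub>R\<^esub> v) = \<zero>\<^bsub>R\<^esub>))"

text \<open>A maximal ideal is prime and proper, hence contains exactly one of two complementary idempotents.\<close>
lemma (in cring) complementary_idempotents_maximalideal:
  assumes M: "maximalideal M R" and ed: "e \<in> carrier R" "d \<in> carrier R"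
    and "e \<oplus> d = \<one>" and "e \<otimes> d = \<zero>"
  shows "d \<in> M \<longleftrightarrow> e \<notin> M"
proof -
  interpret primeideal M R
    using maximalideal_prime[OF M] .
  have "e \<in> M \<or> d \<in> M"
    using I_prime[OF ed] assms by simp
  moreover have "\<not> (e \<in> M \<and> d \<in> M)"
    using a_closed[of e d] assms maximalideal_proper[OF M] by auto
  ultimately show ?thesis
    by blast
qed

lemma (in cring) clopen_maximal_ideals_off:
  assumes ed: "e \<in> carrier R" "d \<in> carrier R" "e \<oplus> d = \<one>" "e \<otimes> d = \<zero>"
  shows "openin (structure_space R) (maximal_ideals_off R e)"
    and "closedin (structure_space R) (maximal_ideals_off R e)"
proof -
  show "openin (structure_space R) (maximal_ideals_off R e)"
    using ed by (intro openin_maximal_ideals_off)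
  have "maximal_ideals R - maximal_ideals_off R e = maximal_ideals_off R d"
    using complementary_idempotents_maximalideal[OF _ ed]
    by (auto simp: maximal_ideals_at_def maximal_ideals_def)
  with openin_maximal_ideals_off[OF ed(2)]
  show "closedin (structure_space R) (maximal_ideals_off R e)"
    by (auto simp: closedin_def topspace_structure_space)
qed

text \<open>
  Inside every basic neighbourhood of \<open>M\<close>, given by \<open>f \<notin> M\<close>, there is one given by an idempotent
  multiple \<open>e\<close> of \<open>f\<close>: a maximal ideal that misses \<open>e\<close> also misses \<open>f\<close>.
\<close>
lemma (in cring) exchange_ring_zero_dimensional:
  assumes ex: "exchange_ring R"
  shows "zero_dimensional_space (structure_space R)"
  unfolding zero_dimensional_space_def
proof (intro exI conjI allI impI)
  let ?B = "{V. openin (structure_space R) V \<and> closedin (structure_space R) V}"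
  show "\<forall>U\<in>?B. openin (structure_space R) U \<and> closedin (structure_space R) U"
    by blast
  fix U M
  assume UM: "openin (structure_space R) U \<and> M \<in> U"
  then have Mmem: "M \<in> maximal_ideals R"
    using openin_subset topspace_structure_space by blast
  then have M: "maximalideal M R"
    by (simp add: maximal_ideals_def)
  interpret M: ideal M R
    using M by (rule maximalideal.axioms)
  obtain f where f: "f \<in> carrier R" "f \<notin> M" "maximal_ideals_off R f \<subseteq> U"
    using structure_space_neighbourhood UM by metis
  obtain g m where g: "g \<in> carrier R" and m: "m \<in> M" and fgm: "f \<otimes> g \<oplus> m = \<one>"
    using maximalideal_comaximal[OF M f(1,2)] .
  have mc: "m \<in> carrier R"
    using m by (rule M.Icarr)
  obtain u v where u: "u \<in> carrier R" and v: "v \<in> carrier R"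
    and sum: "(f \<otimes> g \<otimes> u) \<oplus> (m \<otimes> v) = \<one>" and prod: "(f \<otimes> g \<otimes> u) \<otimes> (m \<otimes> v) = \<zero>"
    using ex f g mc fgm unfolding exchange_ring_def by (metis m_closed)
  let ?e = "f \<otimes> g \<otimes> u" and ?d = "m \<otimes> v"
  have ed: "?e \<in> carrier R" "?d \<in> carrier R"
    using f g u v mc by auto
  have "?d \<in> M"
    using m v by (rule M.I_r_closed)
  then have "?e \<notin> M"
    using complementary_idempotents_maximalideal[OF M ed sum prod] by simp
  then have in_off: "M \<in> maximal_ideals_off R ?e"
    using Mmem by (simp add: maximal_ideals_at_def)
  have "?e \<in> N" if "maximalideal N R" "f \<in> N" for N
    using that f g u ideal.I_r_closed[OF maximalideal.axioms(1)[OF that(1)]] by blast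
  then have "maximal_ideals_off R ?e \<subseteq> maximal_ideals_off R f"
    by (auto simp: maximal_ideals_at_def maximal_ideals_def)
  with in_off f(3) clopen_maximal_ideals_off[OF ed sum prod]
  show "\<exists>V\<in>?B. M \<in> V \<and> V \<subseteq> U"
    by blast
qed

text \<open>The space is T0 because distinct maximal ideals are incomparable.\<close>
lemma (in cring) exchange_ring_Hausdorff:
  assumes "exchange_ring R"
  shows "Hausdorff_space (structure_space R)"
proof (rule zero_dimensional_T0_imp_Hausdorff[OF exchange_ring_zero_dimensional[OF assms]])
  fix M N
  assume "M \<in> topspace (structure_space R)" "N \<in> topspace (structure_space R)" "M \<noteq> N"
  then have M: "maximalideal M R" and N: "maximalideal N R"
    by (auto simp: topspace_structure_space maximal_ideals_def)
  have "\<not> N \<subseteq> M"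
  proof
    assume "N \<subseteq> M"
    then have "M = carrier R"
      using maximalideal.I_maximal[OF N maximalideal.axioms(1)[OF M]] \<open>M \<noteq> N\<close>
        ideal.Icarr[OF maximalideal.axioms(1)[OF M]] by blast
    then show False
      using maximalideal_proper[OF M] by simp
  qed
  then obtain f where f: "f \<in> N" "f \<notin> M"
    by blast
  then have "f \<in> carrier R"
    using ideal.Icarr[OF maximalideal.axioms(1)[OF N]] by blast
  then show "\<exists>U. openin (structure_space R) U \<and> M \<in> U \<and> N \<notin> U"
    using f M N openin_maximal_ideals_off
    by (intro exI[of _ "maximal_ideals_off R f"]) (auto simp: maximal_ideals_at_def maximal_ideals_def)
qed

section \<open>Continuity in an ordered field\<close>

text \<open>
  The field need not be Archimedean, so there is no real-valued norm; the absolute value with values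
  in the field itself takes its place, because intervals around a point form a base at that point.
\<close>
lemma continuous_map_linordered_field_iff:
  fixes f :: "'a \<Rightarrow> 'f::{linordered_field, linorder_topology}"
  shows "continuous_map X euclidean f \<longleftrightarrow>
    (\<forall>x\<in>topspace X. \<forall>\<epsilon>>0. \<exists>U. openin X U \<and> x \<in> U \<and> (\<forall>y\<in>U. \<bar>f y - f x\<bar> < \<epsilon>))"
    (is "?cont \<longleftrightarrow> ?eps")
proof
  assume L: ?cont
  show ?eps
  proof (intro ballI allI impI)
    fix x and \<epsilon> :: 'f
    assume x: "x \<in> topspace X" and "0 < \<epsilon>"
    have "openin euclidean {f x - \<epsilon><..<f x + \<epsilon>}"
      by simp
    with L have "openin X {y \<in> topspace X. f y \<in> {f x - \<epsilon><..<f x + \<epsilon>}}"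
      by (rule openin_continuous_map_preimage)
    then show "\<exists>U. openin X U \<and> x \<in> U \<and> (\<forall>y\<in>U. \<bar>f y - f x\<bar> < \<epsilon>)"
      using x \<open>0 < \<epsilon>\<close>
      by (intro exI[of _ "{y \<in> topspace X. f y \<in> {f x - \<epsilon><..<f x + \<epsilon>}}"]) (auto simp: abs_less_iff algebra_simps)
  qed
next
  assume R: ?eps
  show ?cont
    unfolding continuous_map_def
  proof (intro conjI allI impI)
    show "f \<in> topspace X \<rightarrow> topspace euclidean"
      by simp
    fix V :: "'f set"
    assume "openin euclidean V"
    then have V: "open V"
      by simp
    show "openin X {x \<in> topspace X. f x \<in> V}"
    proof (subst openin_subopen, intro ballI)
      fix x
      assume "x \<in> {x \<in> topspace X. f x \<in> V}"
      then have x: "x \<in> topspace X" "f x \<in> V"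
        by auto
      obtain b where b: "f x < b" "{f x..<b} \<subseteq> V"
        using open_right[OF V x(2), of "f x + 1"] by auto
      obtain a where a: "a < f x" "{a<..f x} \<subseteq> V"
        using open_left[OF V x(2), of "f x - 1"] by auto
      have pos: "0 < min (b - f x) (f x - a)"
        using a b by simp
      obtain U where U: "openin X U" "x \<in> U" "\<And>y. y \<in> U \<Longrightarrow> \<bar>f y - f x\<bar> < min (b - f x) (f x - a)"
        using R[rule_format, OF x(1) pos] by blast
      have "f y \<in> V" if "y \<in> U" for y
      proof (cases "f x \<le> f y")
        case True
        then have "f y \<in> {f x..<b}"
          using U(3)[OF that] by auto
        then show ?thesis
          using b by blast
      next
        case False
        then have "f y \<in> {a<..f x}"
          using U(3)[OF that] by auto
        then show ?thesis
          using a by blast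
      qed
      then show "\<exists>T. openin X T \<and> x \<in> T \<and> T \<subseteq> {x \<in> topspace X. f x \<in> V}"
        using U(1,2) openin_subset[OF U(1)] by blast
    qed
  qed
qed

text \<open>
  Continuity of a binary operation at a point, in terms of the order. It is a pointwise notion so
  that it also covers inversion, which is treated as an operation that ignores its second argument.
\<close>
definition eps_continuous_at2 ::
    "('f \<Rightarrow> 'f \<Rightarrow> 'f::linordered_field) \<Rightarrow> 'f \<Rightarrow> 'f \<Rightarrow> bool" where
  "eps_continuous_at2 h a b \<longleftrightarrow>
     (\<forall>\<epsilon>>0. \<exists>\<delta>>0. \<forall>a' b'. \<bar>a' - a\<bar> < \<delta> \<longrightarrow> \<bar>b' - b\<bar> < \<delta> \<longrightarrow> \<bar>h a' b' - h a b\<bar> < \<epsilon>)"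

lemma eps_continuous_add: "eps_continuous_at2 (+) a b"
  unfolding eps_continuous_at2_def
proof (intro allI impI)
  fix \<epsilon> :: 'a
  assume "0 < \<epsilon>"
  moreover have "\<bar>(a' + b') - (a + b)\<bar> < \<epsilon>" if "\<bar>a' - a\<bar> < \<epsilon> / 2" "\<bar>b' - b\<bar> < \<epsilon> / 2" for a' b'
  proof -
    have "\<bar>(a' + b') - (a + b)\<bar> \<le> \<bar>a' - a\<bar> + \<bar>b' - b\<bar>"
      by linarith
    also have "\<dots> < \<epsilon> / 2 + \<epsilon> / 2"
      using that by (rule add_strict_mono)
    finally show ?thesis
      by simp
  qed
  ultimately show "\<exists>\<delta>>0. \<forall>a' b'. \<bar>a' - a\<bar> < \<delta> \<longrightarrow> \<bar>b' - b\<bar> < \<delta> \<longrightarrow> \<bar>(a' + b') - (a + b)\<bar> < \<epsilon>"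
    by (intro exI[of _ "\<epsilon> / 2"]) auto
qed

lemma eps_continuous_mult: "eps_continuous_at2 (*) a b"
  unfolding eps_continuous_at2_def
proof (intro allI impI)
  fix \<epsilon> :: 'a
  assume eps: "0 < \<epsilon>"
  (* a' b' - a b = (a' - a) (b' - b) + a (b' - b) + b (a' - a), which is
     less than \<delta> c in absolute value because \<delta> \<le> 1. *)
  define c where "c = 1 + \<bar>a\<bar> + \<bar>b\<bar>"
  define \<delta> where "\<delta> = min 1 (\<epsilon> / c)"
  have c: "0 < c"
    by (simp add: c_def add_pos_nonneg)
  then have \<delta>: "0 < \<delta>" "\<delta> \<le> 1" "\<delta> \<le> \<epsilon> / c"
    using eps by (auto simp: \<delta>_def)
  have "\<bar>a' * b' - a * b\<bar> < \<epsilon>" if a': "\<bar>a' - a\<bar> < \<delta>" and b': "\<bar>b' - b\<bar> < \<delta>" for a' b'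
  proof -
    have "a' * b' - a * b = (a' - a) * (b' - b) + a * (b' - b) + b * (a' - a)"
      by (simp add: algebra_simps)
    also have "\<bar>\<dots>\<bar> \<le> \<bar>a' - a\<bar> * \<bar>b' - b\<bar> + \<bar>a\<bar> * \<bar>b' - b\<bar> + \<bar>b\<bar> * \<bar>a' - a\<bar>"
      by (metis (no_types, opaque_lifting) abs_mult abs_triangle_ineq add_mono_thms_linordered_semiring(3) order_trans)
    also have "\<dots> \<le> 1 * \<bar>b' - b\<bar> + \<bar>a\<bar> * \<bar>b' - b\<bar> + \<bar>b\<bar> * \<delta>"
      using a' \<delta>(2) by (intro add_mono mult_right_mono mult_left_mono) auto
    also have "\<dots> = (1 + \<bar>a\<bar>) * \<bar>b' - b\<bar> + \<bar>b\<bar> * \<delta>"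
      by (simp add: algebra_simps)
    also have "\<dots> < (1 + \<bar>a\<bar>) * \<delta> + \<bar>b\<bar> * \<delta>"
      using b' by (intro add_strict_right_mono mult_strict_left_mono) (auto simp: add_pos_nonneg)
    also have "\<dots> = c * \<delta>"
      by (simp add: c_def algebra_simps)
    also have "\<dots> \<le> \<epsilon>"
      using \<delta>(3) c by (simp add: field_simps)
    finally show ?thesis .
  qed
  then show "\<exists>\<delta>>0. \<forall>a' b'. \<bar>a' - a\<bar> < \<delta> \<longrightarrow> \<bar>b' - b\<bar> < \<delta> \<longrightarrow> \<bar>a' * b' - a * b\<bar> < \<epsilon>"
    using \<delta>(1) by blast
qed

lemma eps_continuous_inverse:
  assumes a: "a \<noteq> 0"
  shows "eps_continuous_at2 (\<lambda>x _. inverse x) a b"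
  unfolding eps_continuous_at2_def
proof (intro allI impI)
  fix \<epsilon> :: 'a
  assume eps: "0 < \<epsilon>"
  (* The first bound keeps a' away from 0, so that |1/a' - 1/a| \<le> 2 |a' - a| / (a a). *)
  define \<delta> where "\<delta> = min (\<bar>a\<bar> / 2) (\<epsilon> * (\<bar>a\<bar> * \<bar>a\<bar>) / 2)"
  have \<delta>: "0 < \<delta>" "\<delta> \<le> \<bar>a\<bar> / 2" "\<delta> \<le> \<epsilon> * (\<bar>a\<bar> * \<bar>a\<bar>) / 2"
    using eps a by (auto simp: \<delta>_def zero_less_mult_iff)
  have "\<bar>inverse a' - inverse a\<bar> < \<epsilon>" if a': "\<bar>a' - a\<bar> < \<delta>" for a'
  proof -
    have half: "\<bar>a\<bar> / 2 < \<bar>a'\<bar>"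
      using a' \<delta>(2) by linarith
    then have nz: "a' \<noteq> 0"
      using a by auto
    have "\<bar>inverse a' - inverse a\<bar> * (\<bar>a'\<bar> * \<bar>a\<bar>) = \<bar>(inverse a' - inverse a) * (a' * a)\<bar>"
      by (simp add: abs_mult)
    also have "(inverse a' - inverse a) * (a' * a) = a - a'"
      using nz a by (simp add: field_simps)
    also have "\<bar>a - a'\<bar> < \<epsilon> * (\<bar>a\<bar> * \<bar>a\<bar>) / 2"
      using a' \<delta>(3) by (simp add: abs_minus_commute)
    also have "\<dots> = (\<epsilon> * \<bar>a\<bar>) * (\<bar>a\<bar> / 2)"
      by simp
    also have "\<dots> \<le> (\<epsilon> * \<bar>a\<bar>) * \<bar>a'\<bar>"
      using half eps by (intro mult_left_mono) auto
    also have "\<dots> = \<epsilon> * (\<bar>a'\<bar> * \<bar>a\<bar>)"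
      by (simp add: algebra_simps)
    finally show ?thesis
      using nz a by (simp add: mult_less_cancel_right)
  qed
  then show "\<exists>\<delta>>0. \<forall>a' b'. \<bar>a' - a\<bar> < \<delta> \<longrightarrow> \<bar>b' - b\<bar> < \<delta> \<longrightarrow> \<bar>inverse a' - inverse a\<bar> < \<epsilon>"
    using \<delta>(1) by blast
qed

section \<open>The ring of continuous functions with countable range\<close>

lemma countable_range_ring_simps [simp]:
  "mult (countable_range_ring X) f g = (\<lambda>x\<in>topspace X. f x * g x)"
  "add (countable_range_ring X) f g = (\<lambda>x\<in>topspace X. f x + g x)"
  "one (countable_range_ring X) = (\<lambda>x\<in>topspace X. 1)"
  "zero (countable_range_ring X) = (\<lambda>x\<in>topspace X. 0)"
  by (simp_all add: countable_range_ring_def)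

lemma countable_range_ring_carrier:
  "f \<in> carrier (countable_range_ring X) \<longleftrightarrow>
     f \<in> extensional (topspace X) \<and> continuous_map X euclidean f \<and> countable (f ` topspace X)"
  by (simp add: countable_range_ring_def)

text \<open>
  Cutting off at a clopen set preserves continuity, so \<open>h\<close> has to be continuous only at the values
  taken on \<open>E\<close>. With \<open>E\<close> the whole space this yields sums and products, with constant \<open>h\<close> the
  indicator of \<open>E\<close>, and with inversion a local inverse of a function without zeros on \<open>E\<close>.
\<close>
lemma countable_range_ring_piecewise:
  fixes f g :: "'a \<Rightarrow> 'f::{linordered_field, linorder_topology}"
  assumes f: "f \<in> carrier (countable_range_ring X)" and g: "g \<in> carrier (countable_range_ring X)"
    and E: "openin X E" "closedin X E"
    and h: "\<And>x. x \<in> E \<Longrightarrow> eps_continuous_at2 h (f x) (g x)"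
  shows "(\<lambda>x\<in>topspace X. if x \<in> E then h (f x) (g x) else 0) \<in> carrier (countable_range_ring X)"
    (is "?k \<in> _")
proof -
  have "continuous_map X euclidean ?k"
    unfolding continuous_map_linordered_field_iff
  proof (intro ballI allI impI)
    fix x and \<epsilon> :: 'f
    assume x: "x \<in> topspace X" and eps: "0 < \<epsilon>"
    show "\<exists>U. openin X U \<and> x \<in> U \<and> (\<forall>y\<in>U. \<bar>?k y - ?k x\<bar> < \<epsilon>)"
    proof (cases "x \<in> E")
      case True
      then obtain \<delta> where "0 < \<delta>"
        and \<delta>: "\<And>a b. \<lbrakk>\<bar>a - f x\<bar> < \<delta>; \<bar>b - g x\<bar> < \<delta>\<rbrakk> \<Longrightarrow> \<bar>h a b - h (f x) (g x)\<bar> < \<epsilon>"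
        using h eps unfolding eps_continuous_at2_def by meson
      obtain U where U: "openin X U" "x \<in> U" "\<And>y. y \<in> U \<Longrightarrow> \<bar>f y - f x\<bar> < \<delta>"
        using f x \<open>0 < \<delta>\<close> unfolding countable_range_ring_carrier continuous_map_linordered_field_iff
        by meson
      obtain V where V: "openin X V" "x \<in> V" "\<And>y. y \<in> V \<Longrightarrow> \<bar>g y - g x\<bar> < \<delta>"
        using g x \<open>0 < \<delta>\<close> unfolding countable_range_ring_carrier continuous_map_linordered_field_iff
        by meson
      have "openin X (U \<inter> V \<inter> E)"
        using U(1) V(1) E(1) by blast
      moreover have "\<bar>?k y - ?k x\<bar> < \<epsilon>" if y: "y \<in> U \<inter> V \<inter> E" for y
      proof -
        have "y \<in> topspace X"
          using y openin_subset[OF E(1)] by blast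
        then show ?thesis
          using y x True \<delta>[OF U(3) V(3), of y y] by simp
      qed
      ultimately show ?thesis
        using U(2) V(2) True by blast
    next
      case False
      then have "openin X (topspace X - E)" "x \<in> topspace X - E"
        using E(2) x by (auto simp: closedin_def)
      moreover have "\<bar>?k y - ?k x\<bar> < \<epsilon>" if "y \<in> topspace X - E" for y
        using that x False eps by simp
      ultimately show ?thesis
        by blast
    qed
  qed
  moreover have "countable (?k ` topspace X)"
  proof (rule countable_subset)
    show "?k ` topspace X \<subseteq> insert 0 ((\<lambda>(a, b). h a b) ` (f ` topspace X \<times> g ` topspace X))"
      by auto
    show "countable (insert 0 ((\<lambda>(a, b). h a b) ` (f ` topspace X \<times> g ` topspace X)))"
      using f g by (simp add: countable_range_ring_carrier)
  qed
  ultimately show ?thesis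
    by (simp add: countable_range_ring_carrier)
qed

lemma countable_range_ring_binary:
  assumes "f \<in> carrier (countable_range_ring X)" "g \<in> carrier (countable_range_ring X)"
    and "\<And>a b. eps_continuous_at2 h a b"
  shows "(\<lambda>x\<in>topspace X. h (f x) (g x)) \<in> carrier (countable_range_ring X)"
proof -
  have "(\<lambda>x\<in>topspace X. h (f x) (g x)) = (\<lambda>x\<in>topspace X. if x \<in> topspace X then h (f x) (g x) else 0)"
    by (rule restrict_ext) simp
  also have "\<dots> \<in> carrier (countable_range_ring X)"
    using assms by (intro countable_range_ring_piecewise) auto
  finally show ?thesis .
qed

lemma countable_range_ring_const:
  "(\<lambda>x\<in>topspace X. c) \<in> carrier (countable_range_ring X)"
proof -
  have "countable ((\<lambda>x\<in>topspace X. c) ` topspace X)"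
    by (rule countable_subset[of _ "{c}"]) auto
  moreover have "continuous_map X euclidean (\<lambda>x\<in>topspace X. c)"
    by (rule continuous_map_eq[of X euclidean "\<lambda>_. c"]) auto
  ultimately show ?thesis
    by (simp add: countable_range_ring_carrier)
qed

lemma cring_countable_range_ring:
  fixes X :: "'a topology"
  shows "cring (countable_range_ring X :: ('a \<Rightarrow> 'f::{linordered_field, linorder_topology}) ring)"
    (is "cring ?R")
proof (rule cringI)
  have add: "(\<lambda>x\<in>topspace X. f x + g x) \<in> carrier ?R"
    and mult: "(\<lambda>x\<in>topspace X. f x * g x) \<in> carrier ?R"
    if "f \<in> carrier ?R" "g \<in> carrier ?R" for f g
    using countable_range_ring_binary[OF that, of "(+)"] countable_range_ring_binary[OF that, of "(*)"]
    by (simp_all add: eps_continuous_add eps_continuous_mult)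
  have ext: "(\<lambda>x\<in>topspace X. f x) = f" if "f \<in> carrier ?R" for f
    using that by (simp add: countable_range_ring_carrier extensional_restrict)
  show "abelian_group ?R"
  proof (rule abelian_groupI)
    fix f
    assume f: "f \<in> carrier ?R"
    have "(\<lambda>x\<in>topspace X. (\<lambda>x\<in>topspace X. -1) x * f x) \<in> carrier ?R"
      using countable_range_ring_const f by (rule mult)
    moreover have "(\<lambda>x\<in>topspace X. (\<lambda>x\<in>topspace X. (\<lambda>x\<in>topspace X. -1) x * f x) x + f x) = \<zero>\<^bsub>?R\<^esub>"
      by (auto intro!: restrict_ext)
    ultimately show "\<exists>g\<in>carrier ?R. g \<oplus>\<^bsub>?R\<^esub> f = \<zero>\<^bsub>?R\<^esub>"
      unfolding countable_range_ring_simps by blast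
    show "\<zero>\<^bsub>?R\<^esub> \<oplus>\<^bsub>?R\<^esub> f = f"
      using ext[OF f] by (simp cong: restrict_cong)
  qed (auto simp: add countable_range_ring_const add_ac intro!: restrict_ext)
  show "comm_monoid ?R"
  proof (rule comm_monoidI)
    fix f
    assume f: "f \<in> carrier ?R"
    show "\<one>\<^bsub>?R\<^esub> \<otimes>\<^bsub>?R\<^esub> f = f"
      using ext[OF f] by (simp cong: restrict_cong)
  qed (auto simp: mult countable_range_ring_const mult_ac intro!: restrict_ext)
qed (auto simp: distrib_right intro!: restrict_ext)

definition clopen_indicator :: "'a topology \<Rightarrow> 'a set \<Rightarrow> 'a \<Rightarrow> 'f::{linordered_field, linorder_topology}" where
  "clopen_indicator X E = (\<lambda>x\<in>topspace X. if x \<in> E then 1 else 0)"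

lemma clopen_indicator_carrier:
  assumes "openin X E" "closedin X E"
  shows "clopen_indicator X E \<in> carrier (countable_range_ring X)"
  unfolding clopen_indicator_def
  by (rule countable_range_ring_piecewise[OF countable_range_ring_const[where c = 0]
        countable_range_ring_const[where c = 0] assms, where h = "\<lambda>_ _. 1"])
    (auto simp: eps_continuous_at2_def intro!: exI[of _ 1])

lemma clopen_indicator_algebra:
  "clopen_indicator X {} = zero (countable_range_ring X)"
  "clopen_indicator X (topspace X) = one (countable_range_ring X)"
  "add (countable_range_ring X) (clopen_indicator X E) (clopen_indicator X (topspace X - E)) =
     one (countable_range_ring X)"
  "mult (countable_range_ring X) (clopen_indicator X E) (clopen_indicator X D) = clopen_indicator X (E \<inter> D)"
  by (auto simp: clopen_indicator_def intro!: restrict_ext)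

lemma maximalideal_clopen_indicator_Compl:
  assumes "maximalideal M (countable_range_ring X)" and E: "openin X E" "closedin X E"
  shows "clopen_indicator X (topspace X - E) \<in> M \<longleftrightarrow> clopen_indicator X E \<notin> M"
proof -
  have "openin X (topspace X - E)" "closedin X (topspace X - E)"
    using E by (auto intro: closedin_diff)
  then show ?thesis
    using assms cring_countable_range_ring clopen_indicator_algebra(1,3)[of X] clopen_indicator_algebra(4)[of X E]
    by (intro cring.complementary_idempotents_maximalideal[of "countable_range_ring X"] clopen_indicator_carrier)
      (auto simp: clopen_indicator_algebra(4) simp del: countable_range_ring_simps)
qed

lemma maximalideal_clopen_indicator_Int:
  assumes M: "maximalideal M (countable_range_ring X)"
    and E: "openin X E" "closedin X E" "clopen_indicator X E \<notin> M"
    and D: "openin X D" "closedin X D" "clopen_indicator X D \<notin> M"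
  shows "clopen_indicator X (E \<inter> D) \<notin> M"
  using primeideal.I_prime[OF cring.maximalideal_prime[OF cring_countable_range_ring M]
      clopen_indicator_carrier[OF E(1,2)] clopen_indicator_carrier[OF D(1,2)]] E(3) D(3)
  unfolding clopen_indicator_algebra(4) by blast

section \<open>Cuts missed by countable sets and the exchange property\<close>

text \<open>
  The interval has the cardinality of the field: \<open>y \<mapsto> 1 / y - 1\<close> maps it onto the positive elements,
  and these with their negatives and zero make up everything.
\<close>
lemma uncountable_linordered_field_unit_interval:
  assumes "uncountable (UNIV :: 'f::linordered_field set)"
  shows "uncountable {0<..<1::'f}"
proof
  assume c: "countable {0<..<1::'f}"
  have "x \<in> (\<lambda>y. inverse y - 1) ` {0<..<1}" if "0 < x" for x :: 'f
    using that by (intro image_eqI[of _ _ "inverse (x + 1)"]) (auto simp: field_simps)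
  then have pos: "countable {(0::'f)<..}"
    using c by (intro countable_subset[of "{(0::'f)<..}" "(\<lambda>y. inverse y - 1) ` {0<..<1}"]) auto
  have "x \<in> {0<..} \<union> uminus ` {0<..} \<union> {0}" for x :: 'f
    by (cases "0::'f" x rule: linorder_cases) (auto intro!: image_eqI[of _ _ "- x"])
  then have "(UNIV :: 'f set) = {0<..} \<union> uminus ` {0<..} \<union> {0}"
    by blast
  then show False
    using assms pos by (metis countable_Un countable_empty countable_image countable_insert)
qed

text \<open>
  The subfield contains the numbers \<open>1 / n\<close>, which are small in the reals. This is what makes its own
  order topology as fine as the one inherited from the reals, where rays with irrational endpoints
  are open.
\<close>
lemma ordered_subfield_of_reals_small:
  fixes h :: "'f::linordered_field \<Rightarrow> real"
  assumes one: "h 1 = 1" and add: "\<And>x y. h (x + y) = h x + h y"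
    and mult: "\<And>x y. h (x * y) = h x * h y" and "0 < \<epsilon>"
  obtains z where "0 < h z" "h z < \<epsilon>"
proof -
  have zero: "h 0 = 0"
    using add[of 0 0] by simp
  have nat: "h (of_nat n) = real n" for n
    by (induction n) (simp_all add: zero one add)
  obtain n where n: "0 < n" "inverse (real n) < \<epsilon>"
    using ex_inverse_of_nat_less[OF \<open>0 < \<epsilon>\<close>] by blast
  have "h (inverse (of_nat n)) * real n = 1"
    using mult[of "inverse (of_nat n)" "of_nat n"] n(1) by (simp add: one nat)
  then have "h (inverse (of_nat n)) = inverse (real n)"
    by (metis inverse_unique mult.commute)
  then show thesis
    using that[of "inverse (of_nat n)"] n by simp
qed

text \<open>
  A ray is open even if its endpoint \<open>r\<close> is a real number outside the field: below a point \<open>x\<close> of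
  \<open>(r, \<infinity>)\<close> there is a point \<open>x - z\<close> of the field which is above \<open>r\<close>.
\<close>
lemma open_subfield_rays:
  fixes h :: "'f::{linordered_field, linorder_topology} \<Rightarrow> real"
  assumes one: "h 1 = 1" and add: "\<And>x y. h (x + y) = h x + h y"
    and mult: "\<And>x y. h (x * y) = h x * h y" and mono: "strict_mono h"
  shows "open {x. r < h x}" and "open {x. h x < r}"
proof -
  have diff: "h (x - y) = h x - h y" for x y
    using add[of "x - y" y] by simp
  show "open {x. r < h x}"
  proof (rule Topological_Spaces.openI)
    fix x
    assume "x \<in> {x. r < h x}"
    then obtain z where z: "0 < h z" "h z < h x - r"
      using ordered_subfield_of_reals_small[OF one add mult, of "h x - r"] by auto
    then have "h (x - z) < h x"
      by (simp add: diff)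
    then have "x \<in> {x - z<..}"
      using mono by (simp add: strict_mono_less)
    moreover have "{x - z<..} \<subseteq> {x. r < h x}"
    proof
      fix y
      assume "y \<in> {x - z<..}"
      then have "h (x - z) < h y"
        using mono by (simp add: strict_mono_less)
      then show "y \<in> {x. r < h x}"
        using z by (simp add: diff)
    qed
    ultimately show "\<exists>T. open T \<and> x \<in> T \<and> T \<subseteq> {x. r < h x}"
      using open_greaterThan by blast
  qed
  show "open {x. h x < r}"
  proof (rule Topological_Spaces.openI)
    fix x
    assume "x \<in> {x. h x < r}"
    then obtain z where z: "0 < h z" "h z < r - h x"
      using ordered_subfield_of_reals_small[OF one add mult, of "r - h x"] by auto
    then have "h x < h (x + z)"
      by (simp add: add)
    then have "x \<in> {..<x + z}"
      using mono by (simp add: strict_mono_less)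
    moreover have "{..<x + z} \<subseteq> {x. h x < r}"
    proof
      fix y
      assume "y \<in> {..<x + z}"
      then have "h y < h (x + z)"
        using mono by (simp add: strict_mono_less)
      then show "y \<in> {x. h x < r}"
        using z by (simp add: add)
    qed
    ultimately show "\<exists>T. open T \<and> x \<in> T \<and> T \<subseteq> {x. h x < r}"
      using open_lessThan by blast
  qed
qed

text \<open>
  An uncountable field has a point of \<open>(0, 1)\<close> outside \<open>S\<close>, at which to cut. A countable field may be
  exhausted by \<open>S\<close>; the cut is then at a real number outside it. This is the only place where
  the hypothesis on the field enters.
\<close>
lemma countable_set_open_cut:
  fixes S :: "'f::{linordered_field, linorder_topology} set"
  assumes F: "uncountable (UNIV :: 'f set) \<or>
      (countable (UNIV :: 'f set) \<and> ordered_subfield_of_reals TYPE('f))"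
    and S: "countable S"
  obtains L U where "open L" "open U" "L \<inter> U = {}" "S \<subseteq> L \<union> U" "0 \<in> L" "1 \<in> U"
proof -
  consider "uncountable (UNIV :: 'f set)"
    | "countable (UNIV :: 'f set)" "ordered_subfield_of_reals TYPE('f)"
    using F by blast
  then show thesis
  proof cases
    case 1
    obtain c where c: "c \<in> {0<..<1::'f}" "c \<notin> S"
      using uncountable_linordered_field_unit_interval[OF 1] S countable_subset[of "{0<..<1}" S] by blast
    have "S \<subseteq> {..<c} \<union> {c<..}"
    proof
      fix x
      assume "x \<in> S"
      then show "x \<in> {..<c} \<union> {c<..}"
        using c(2) by (cases x c rule: linorder_cases) auto
    qed
    with c(1) show thesis
      by (intro that[of "{..<c}" "{c<..}"]) auto
  next
    case 2
    then obtain h :: "'f \<Rightarrow> real" where h: "h 1 = 1" "\<And>x y. h (x + y) = h x + h y"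
      "\<And>x y. h (x * y) = h x * h y" "strict_mono h"
      unfolding ordered_subfield_of_reals_def by blast
    have "uncountable {0<..<1::real}"
      by (simp add: uncountable_open_interval)
    moreover have "countable (range h)"
      using 2(1) by simp
    ultimately obtain r where r: "r \<in> {0<..<1}" "r \<notin> range h"
      using countable_subset[of "{0<..<1}" "range h"] by blast
    have "h 0 = 0"
      using h(2)[of 0 0] by simp
    moreover have "x \<in> {x. h x < r} \<union> {x. r < h x}" for x
      using r(2) by (cases "h x" r rule: linorder_cases) auto
    ultimately show thesis
      using r(1) h(1) open_subfield_rays[OF h]
      by (intro that[of "{x. h x < r}" "{x. r < h x}"]) auto
  qed
qed

lemma countable_range_ring_clopen_separation:
  fixes k :: "'a \<Rightarrow> 'f::{linordered_field, linorder_topology}"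
  assumes F: "uncountable (UNIV :: 'f set) \<or>
      (countable (UNIV :: 'f set) \<and> ordered_subfield_of_reals TYPE('f))"
    and k: "k \<in> carrier (countable_range_ring X)"
  obtains E where "openin X E" "closedin X E" "\<And>x. x \<in> E \<Longrightarrow> k x \<noteq> 0"
    "\<And>x. x \<in> topspace X - E \<Longrightarrow> k x \<noteq> 1"
proof -
  have cont: "continuous_map X euclidean k"
    using k by (simp add: countable_range_ring_carrier)
  obtain L U where LU: "open L" "open U" "L \<inter> U = {}" "k ` topspace X \<subseteq> L \<union> U" "0 \<in> L" "1 \<in> U"
    using countable_set_open_cut[OF F, of "k ` topspace X"] k by (auto simp: countable_range_ring_carrier)
  define E where "E = {x \<in> topspace X. k x \<in> U}"
  have op: "openin X {x \<in> topspace X. k x \<in> V}" if "open V" for V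
    using openin_continuous_map_preimage[OF cont, of V] that by simp
  have compl: "topspace X - E = {x \<in> topspace X. k x \<in> L}"
    using LU(3,4) by (auto simp: E_def)
  have "closedin X E"
    using op[OF LU(1)] unfolding closedin_def compl by (auto simp: E_def)
  moreover have "openin X E"
    using op[OF LU(2)] by (simp add: E_def)
  moreover have "k x \<noteq> 0" if "x \<in> E" for x
    using that LU(3,5) by (auto simp: E_def)
  moreover have "k x \<noteq> 1" if "x \<in> topspace X - E" for x
    using that LU(6) by (auto simp: E_def)
  ultimately show thesis
    using that by blast
qed

text \<open>
  Let \<open>k + l = 1\<close>. On a clopen set \<open>E\<close> that separates the ones of \<open>k\<close> from its zeros \<open>k\<close> has a local
  inverse \<open>u\<close>, and off \<open>E\<close> so has \<open>l = 1 - k\<close>, namely \<open>v\<close>. Then \<open>k u\<close> and \<open>l v\<close> are the indicators of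
  \<open>E\<close> and of its complement.
\<close>
lemma exchange_ring_countable_range_ring:
  fixes X :: "'a topology"
  assumes F: "uncountable (UNIV :: 'f::{linordered_field, linorder_topology} set) \<or>
      (countable (UNIV :: 'f set) \<and> ordered_subfield_of_reals TYPE('f))"
  shows "exchange_ring (countable_range_ring X :: ('a \<Rightarrow> 'f) ring)" (is "exchange_ring ?R")
  unfolding exchange_ring_def
proof (intro ballI impI)
  fix k l
  assume k: "k \<in> carrier ?R" and l: "l \<in> carrier ?R" and sum: "k \<oplus>\<^bsub>?R\<^esub> l = \<one>\<^bsub>?R\<^esub>"
  have kl: "k x + l x = 1" if "x \<in> topspace X" for x
    using fun_cong[OF sum, of x] that by simp
  obtain E where E: "openin X E" "closedin X E" and kE: "\<And>x. x \<in> E \<Longrightarrow> k x \<noteq> 0"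
    and kE': "\<And>x. x \<in> topspace X - E \<Longrightarrow> k x \<noteq> 1"
    using countable_range_ring_clopen_separation[OF F k] by metis
  let ?D = "topspace X - E"
  have D: "openin X ?D" "closedin X ?D"
    using E by (auto intro: closedin_diff)
  have lD: "l x \<noteq> 0" if "x \<in> ?D" for x
    using kE'[OF that] kl[of x] that by auto
  define u where "u = (\<lambda>x\<in>topspace X. if x \<in> E then inverse (k x) else 0)"
  define v where "v = (\<lambda>x\<in>topspace X. if x \<in> ?D then inverse (l x) else 0)"
  have u: "u \<in> carrier ?R"
    unfolding u_def
    by (rule countable_range_ring_piecewise[OF k k E, where h = "\<lambda>a _. inverse a"])
      (rule eps_continuous_inverse[OF kE])
  have v: "v \<in> carrier ?R"
    unfolding v_def
    by (rule countable_range_ring_piecewise[OF l l D, where h = "\<lambda>a _. inverse a"])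
      (rule eps_continuous_inverse[OF lD])
  have "k \<otimes>\<^bsub>?R\<^esub> u = clopen_indicator X E"
    using kE by (auto simp: u_def clopen_indicator_def intro!: restrict_ext)
  moreover have "l \<otimes>\<^bsub>?R\<^esub> v = clopen_indicator X ?D"
    using lD by (auto simp: v_def clopen_indicator_def intro!: restrict_ext)
  ultimately have "(k \<otimes>\<^bsub>?R\<^esub> u) \<oplus>\<^bsub>?R\<^esub> (l \<otimes>\<^bsub>?R\<^esub> v) = \<one>\<^bsub>?R\<^esub>"
    and "(k \<otimes>\<^bsub>?R\<^esub> u) \<otimes>\<^bsub>?R\<^esub> (l \<otimes>\<^bsub>?R\<^esub> v) = \<zero>\<^bsub>?R\<^esub>"
    by (simp_all add: clopen_indicator_algebra Diff_disjoint del: countable_range_ring_simps)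
  with u v show "\<exists>u\<in>carrier ?R. \<exists>v\<in>carrier ?R.
      (k \<otimes>\<^bsub>?R\<^esub> u) \<oplus>\<^bsub>?R\<^esub> (l \<otimes>\<^bsub>?R\<^esub> v) = \<one>\<^bsub>?R\<^esub> \<and> (k \<otimes>\<^bsub>?R\<^esub> u) \<otimes>\<^bsub>?R\<^esub> (l \<otimes>\<^bsub>?R\<^esub> v) = \<zero>\<^bsub>?R\<^esub>"
    by blast
qed

section \<open>The embedding of a space into its structure space\<close>

lemma maximalideal_clopen_indicator_empty:
  "maximalideal M (countable_range_ring X) \<Longrightarrow> clopen_indicator X {} \<in> M"
  unfolding clopen_indicator_algebra(1)
  by (intro additive_subgroup.zero_closed ideal.axioms(1) maximalideal.axioms(1))

text \<open>
  An ideal that properly contains the functions vanishing at \<open>p\<close> contains some \<open>f\<close> with \<open>f p \<noteq> 0\<close>.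
  With the constant \<open>c = 1 / f p\<close> the function \<open>1 - c f\<close> vanishes at \<open>p\<close>, so \<open>1 = (1 - c f) + c f\<close>
  lies in the ideal.
\<close>
lemma maximalideal_vanishing_ideal:
  fixes X :: "'a topology"
  assumes p: "p \<in> topspace X"
  shows "maximalideal (vanishing_ideal X p)
           (countable_range_ring X :: ('a \<Rightarrow> 'f::{linordered_field, linorder_topology}) ring)"
    (is "maximalideal ?I ?R")
proof -
  interpret cring ?R
    by (rule cring_countable_range_ring)
  show ?thesis
  proof (rule maximalidealI)
    show "ideal ?I ?R"
    proof (rule ideal_by_absorption)
      show "?I \<subseteq> carrier ?R"
        by (auto simp: vanishing_ideal_def)
      show "\<zero>\<^bsub>?R\<^esub> \<in> ?I"
        using zero_closed p by (simp add: vanishing_ideal_def)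
      show "f \<oplus>\<^bsub>?R\<^esub> g \<in> ?I" if "f \<in> ?I" "g \<in> ?I" for f g
        using that p add.m_closed[of f g] by (simp add: vanishing_ideal_def)
      show "g \<otimes>\<^bsub>?R\<^esub> f \<in> ?I" if "f \<in> ?I" "g \<in> carrier ?R" for f g
        using that p m_closed[of g f] by (simp add: vanishing_ideal_def)
    qed
    have "\<one>\<^bsub>?R\<^esub> \<notin> ?I"
      using p by (simp add: vanishing_ideal_def)
    then show "carrier ?R \<noteq> ?I"
      using one_closed by metis
    fix J
    assume J: "ideal J ?R" "?I \<subseteq> J" "J \<subseteq> carrier ?R"
    show "J = ?I \<or> J = carrier ?R"
    proof (cases "J \<subseteq> ?I")
      case False
      then obtain f where f: "f \<in> J" "f \<notin> ?I"
        by blast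
      then have fc: "f \<in> carrier ?R" and "f p \<noteq> 0"
        using J(3) by (auto simp: vanishing_ideal_def)
      define c :: "'a \<Rightarrow> 'f" where "c = (\<lambda>x\<in>topspace X. inverse (f p))"
      define d :: "'a \<Rightarrow> 'f" where "d = (\<lambda>x\<in>topspace X. - inverse (f p))"
      have c: "c \<in> carrier ?R" and d: "d \<in> carrier ?R"
        unfolding c_def d_def by (rule countable_range_ring_const)+
      let ?h = "\<one>\<^bsub>?R\<^esub> \<oplus>\<^bsub>?R\<^esub> (d \<otimes>\<^bsub>?R\<^esub> f)"
      have "?h \<in> carrier ?R"
        using d fc by (intro a_closed one_closed m_closed)
      moreover have "?h p = 0"
        using p \<open>f p \<noteq> 0\<close> by (simp add: d_def)
      ultimately have "?h \<in> J"
        using J(2) unfolding vanishing_ideal_def by blast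
      moreover have "c \<otimes>\<^bsub>?R\<^esub> f \<in> J"
        using ideal.I_l_closed[OF J(1) f(1) c] .
      ultimately have "?h \<oplus>\<^bsub>?R\<^esub> (c \<otimes>\<^bsub>?R\<^esub> f) \<in> J"
        using additive_subgroup.a_closed[OF ideal.axioms(1)[OF J(1)]] by blast
      moreover have "?h \<oplus>\<^bsub>?R\<^esub> (c \<otimes>\<^bsub>?R\<^esub> f) = \<one>\<^bsub>?R\<^esub>"
        by (auto simp: c_def d_def intro!: restrict_ext)
      ultimately show ?thesis
        using ideal.one_imp_carrier[OF J(1)] by metis
    qed (use J(2) in blast)
  qed
qed

lemma vanishing_ideal_in_maximal_ideals_off:
  assumes "p \<in> topspace X" "f \<in> carrier (countable_range_ring X)"
  shows "vanishing_ideal X p \<in> maximal_ideals_off (countable_range_ring X) f \<longleftrightarrow> f p \<noteq> 0"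
  using assms maximalideal_vanishing_ideal[OF assms(1)]
  by (auto simp: maximal_ideals_at_def maximal_ideals_def vanishing_ideal_def)

lemma clopen_indicator_in_vanishing_ideal:
  fixes X :: "'a topology"
  assumes "p \<in> topspace X" "openin X E" "closedin X E"
  shows "(clopen_indicator X E :: 'a \<Rightarrow> 'f::{linordered_field, linorder_topology})
           \<in> vanishing_ideal X p \<longleftrightarrow> p \<notin> E"
proof -
  have "clopen_indicator X E p = (if p \<in> E then 1 else 0 :: 'f)"
    using assms(1) by (simp add: clopen_indicator_def)
  then show ?thesis
    using assms(2,3) by (simp add: vanishing_ideal_def clopen_indicator_carrier)
qed

text \<open>
  The preimage of the basic open set of \<open>f\<close> is the set where \<open>f \<noteq> 0\<close>. These cozero sets form a base
  of a zero-dimensional space, since every clopen set is the cozero set of its indicator; thus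
  the topology of \<open>X\<close> is exactly the one induced by \<open>\<psi>\<close>.
\<close>
lemma embedding_map_vanishing_ideal:
  fixes X :: "'a topology"
  assumes "Hausdorff_space X" and zd: "zero_dimensional_space X"
  shows "embedding_map X
           (structure_space (countable_range_ring X :: ('a \<Rightarrow> 'f::{linordered_field, linorder_topology}) ring))
           (vanishing_ideal X)"
    (is "embedding_map X (structure_space ?R) ?\<psi>")
proof -
  interpret cring ?R
    by (rule cring_countable_range_ring)
  have range: "?\<psi> p \<in> topspace (structure_space ?R)" if "p \<in> topspace X" for p
    using maximalideal_vanishing_ideal[OF that] by (simp add: topspace_structure_space maximal_ideals_def)
  have cont: "continuous_map X (structure_space ?R) ?\<psi>"
  proof (rule continuous_map_into_topology_base[OF openin_structure_space range])
    fix U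
    assume "\<exists>f\<in>carrier ?R. U = maximal_ideals_off ?R f"
    then obtain f where f: "f \<in> carrier ?R" "U = maximal_ideals_off ?R f"
      by blast
    have "{p \<in> topspace X. ?\<psi> p \<in> U} = {p \<in> topspace X. f p \<in> - {0}}"
      using vanishing_ideal_in_maximal_ideals_off[OF _ f(1)] f(2) by blast
    also have "openin X \<dots>"
      using f(1) by (intro openin_continuous_map_preimage[of X euclidean])
        (auto simp: countable_range_ring_carrier)
    finally show "openin X {p \<in> topspace X. ?\<psi> p \<in> U}" .
  qed
  have sep: "\<exists>f\<in>carrier ?R. f p \<noteq> 0 \<and> (\<forall>q\<in>topspace X. f q \<noteq> 0 \<longrightarrow> q \<in> U)"
    if U: "openin X U" "p \<in> U" for p U
  proof -
    obtain V where V: "openin X V" "closedin X V" "p \<in> V" "V \<subseteq> U"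
      using zero_dimensional_space_clopen_neighbourhood[OF zd U] .
    have "p \<in> topspace X"
      using U openin_subset by blast
    then show ?thesis
      using V clopen_indicator_carrier[OF V(1,2)]
      by (intro bexI[of _ "clopen_indicator X V"]) (auto simp: clopen_indicator_def)
  qed
  have inj: "inj_on ?\<psi> (topspace X)"
  proof (rule inj_onI, rule ccontr)
    fix p q
    assume pq: "p \<in> topspace X" "q \<in> topspace X" "?\<psi> p = ?\<psi> q" "p \<noteq> q"
    then obtain U where "openin X U" "p \<in> U" "q \<notin> U"
      using assms(1) unfolding Hausdorff_space_def disjnt_iff by metis
    then obtain f where "f \<in> carrier ?R" "f p \<noteq> 0" "f q = 0"
      using sep pq(2) by metis
    then show False
      using pq(3) by (auto simp: vanishing_ideal_def)
  qed
  let ?S = "?\<psi> ` topspace X"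
  have "open_map X (subtopology (structure_space ?R) ?S) ?\<psi>"
    unfolding open_map_def
  proof (intro allI impI)
    fix U
    assume U: "openin X U"
    show "openin (subtopology (structure_space ?R) ?S) (?\<psi> ` U)"
    proof (subst openin_subopen, intro ballI)
      fix M
      assume "M \<in> ?\<psi> ` U"
      then obtain p where p: "p \<in> U" "M = ?\<psi> p"
        by blast
      then have pX: "p \<in> topspace X"
        using U openin_subset by blast
      obtain f where f: "f \<in> carrier ?R" "f p \<noteq> 0" "\<And>q. \<lbrakk>q \<in> topspace X; f q \<noteq> 0\<rbrakk> \<Longrightarrow> q \<in> U"
        using sep[OF U p(1)] by blast
      have "openin (subtopology (structure_space ?R) ?S) (maximal_ideals_off ?R f \<inter> ?S)"
        using openin_maximal_ideals_off[OF f(1)] by (rule openin_subtopology_Int)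
      moreover have "M \<in> maximal_ideals_off ?R f \<inter> ?S"
        using vanishing_ideal_in_maximal_ideals_off[OF pX f(1)] f(2) pX p(2) by blast
      moreover have "maximal_ideals_off ?R f \<inter> ?S \<subseteq> ?\<psi> ` U"
        using vanishing_ideal_in_maximal_ideals_off[OF _ f(1)] f(3) by blast
      ultimately show "\<exists>T. openin (subtopology (structure_space ?R) ?S) T \<and> M \<in> T \<and> T \<subseteq> ?\<psi> ` U"
        by blast
    qed
  qed
  then have "homeomorphic_map X (subtopology (structure_space ?R) ?S) ?\<psi>"
    using cont inj range
    by (intro bijective_open_imp_homeomorphic_map)
      (auto simp: continuous_map_in_subtopology topspace_subtopology)
  then show ?thesis
    by (simp add: embedding_map_def)
qed

text \<open>A nonempty basic open set belongs to a nonzero \<open>f\<close>, and contains the ideal of any \<open>p\<close> with \<open>f p \<noteq> 0\<close>.\<close>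
lemma vanishing_ideals_dense:
  fixes X :: "'a topology"
  shows "structure_space (countable_range_ring X :: ('a \<Rightarrow> 'f::{linordered_field, linorder_topology}) ring)
           closure_of (vanishing_ideal X ` topspace X) = topspace (structure_space (countable_range_ring X :: ('a \<Rightarrow> 'f) ring))"
    (is "structure_space ?R closure_of ?S = _")
proof -
  interpret cring ?R
    by (rule cring_countable_range_ring)
  have "M \<in> structure_space ?R closure_of ?S" if M: "M \<in> topspace (structure_space ?R)" for M
    unfolding in_closure_of
  proof (intro conjI allI impI)
    show "M \<in> topspace (structure_space ?R)"
      by (rule M)
    fix U
    assume "M \<in> U \<and> openin (structure_space ?R) U"
    then obtain f where f: "f \<in> carrier ?R" "f \<notin> M" "maximal_ideals_off ?R f \<subseteq> U"
      using structure_space_neighbourhood by metis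
    have "maximalideal M ?R"
      using M by (simp add: topspace_structure_space maximal_ideals_def)
    then have "\<zero>\<^bsub>?R\<^esub> \<in> M"
      by (intro additive_subgroup.zero_closed ideal.axioms(1) maximalideal.axioms(1))
    then have "f \<noteq> (\<lambda>x\<in>topspace X. 0)"
      using f(2) by auto
    moreover have "f = (\<lambda>x\<in>topspace X. 0)" if "\<forall>p\<in>topspace X. f p = 0"
      using that f(1) by (intro extensionalityI[of f "topspace X"]) (auto simp: countable_range_ring_carrier)
    ultimately obtain p where p: "p \<in> topspace X" "f p \<noteq> 0"
      by blast
    then show "\<exists>N. N \<in> ?S \<and> N \<in> U"
      using vanishing_ideal_in_maximal_ideals_off[OF p(1) f(1)] f(3) by blast
  qed
  then show ?thesis
    by (intro subset_antisym closure_of_subset_topspace subsetI)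
qed

lemma compactification_structure_space:
  fixes X :: "'a topology"
  assumes "Hausdorff_space X" "zero_dimensional_space X"
    and "exchange_ring (countable_range_ring X :: ('a \<Rightarrow> 'f::{linordered_field, linorder_topology}) ring)"
  shows "compactification X (vanishing_ideal X) (structure_space (countable_range_ring X :: ('a \<Rightarrow> 'f) ring))"
  unfolding compactification_def
  by (intro conjI cring.compact_space_structure_space cring.exchange_ring_Hausdorff
      cring_countable_range_ring embedding_map_vanishing_ideal vanishing_ideals_dense assms)

section \<open>Extending maps to the structure space\<close>

text \<open>
  For a maximal ideal \<open>M\<close>, the clopen sets \<open>V\<close> of \<open>Y\<close> whose preimages have their indicator outside \<open>M\<close>
  form an ultrafilter: it is closed under intersection because \<open>M\<close> is prime, and contains exactly one
  of \<open>V\<close> and its complement because their indicators are complementary idempotents. Compactness of \<open>Y\<close>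
  gives a point \<open>g M\<close> common to all members. Then \<open>g M \<in> V\<close> is equivalent to \<open>V\<close> being a member, so
  preimages of clopen sets under \<open>g\<close> are basic open sets, and \<open>g (\<psi> x)\<close> lies in the same clopen sets
  as \<open>f x\<close>.
\<close>
lemma structure_space_extension:
  fixes X :: "'a topology" and Y :: "'y topology" and f :: "'a \<Rightarrow> 'y"
  assumes Y: "compact_space Y" "Hausdorff_space Y" "zero_dimensional_space Y"
    and f: "continuous_map X Y f"
  obtains g where
    "continuous_map (structure_space
       (countable_range_ring X :: ('a \<Rightarrow> 'f::{linordered_field, linorder_topology}) ring)) Y g"
    "\<And>x. x \<in> topspace X \<Longrightarrow> g (vanishing_ideal X x) = f x"
proof -
  let ?R = "countable_range_ring X :: ('a \<Rightarrow> 'f) ring"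
  interpret cring ?R
    by (rule cring_countable_range_ring)
  define pre where "pre V = {x \<in> topspace X. f x \<in> V}" for V
  define chi :: "'y set \<Rightarrow> 'a \<Rightarrow> 'f" where "chi V = clopen_indicator X (pre V)" for V
  define \<V> where "\<V> M = {V. openin Y V \<and> closedin Y V \<and> chi V \<notin> M}" for M
  have pre: "openin X (pre V)" "closedin X (pre V)" if "openin Y V" "closedin Y V" for V
    unfolding pre_def using that f
    by (auto intro: openin_continuous_map_preimage closedin_continuous_map_preimage)
  have pre_f: "f x \<in> topspace Y" if "x \<in> topspace X" for x
    using f that by (auto simp: continuous_map_def)
  have chi_Compl: "chi (topspace Y - V) \<in> M \<longleftrightarrow> chi V \<notin> M"
    if "maximalideal M ?R" "openin Y V" "closedin Y V" for M V
  proof -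
    have "pre (topspace Y - V) = topspace X - pre V"
      using pre_f by (auto simp: pre_def)
    then show ?thesis
      using maximalideal_clopen_indicator_Compl[OF that(1) pre[OF that(2,3)]] by (simp add: chi_def)
  qed
  have Y_mem: "topspace Y \<in> \<V> M" if M: "maximalideal M ?R" for M
  proof -
    have "chi (topspace Y) = \<one>\<^bsub>?R\<^esub>"
      using pre_f unfolding chi_def pre_def clopen_indicator_algebra(2)[symmetric]
      by (intro arg_cong[where f = "clopen_indicator X"]) auto
    then show ?thesis
      using maximalideal_proper[OF M] by (simp add: \<V>_def del: countable_range_ring_simps)
  qed
  have Int_mem: "V \<inter> W \<in> \<V> M" if M: "maximalideal M ?R" and VW: "V \<in> \<V> M" "W \<in> \<V> M" for M V W
  proof -
    have "pre (V \<inter> W) = pre V \<inter> pre W"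
      by (auto simp: pre_def)
    then show ?thesis
      using maximalideal_clopen_indicator_Int[OF M, of "pre V" "pre W"] VW pre
      by (auto simp: \<V>_def chi_def)
  qed
  have Inter_mem: "topspace Y \<inter> \<Inter>\<F> \<in> \<V> M"
    if M: "maximalideal M ?R" and "finite \<F>" "\<F> \<subseteq> \<V> M" for M \<F>
    using that(2,3)
  proof (induction \<F> rule: finite_induct)
    case empty
    then show ?case
      using Y_mem[OF M] by simp
  next
    case (insert V \<F>)
    then have "V \<in> \<V> M" "topspace Y \<inter> \<Inter>\<F> \<in> \<V> M"
      by simp_all
    then have "V \<inter> (topspace Y \<inter> \<Inter>\<F>) \<in> \<V> M"
      by (rule Int_mem[OF M])
    then show ?case
      by (simp add: Int_left_commute)
  qed
  have empty: "{} \<notin> \<V> M" if M: "maximalideal M ?R" for M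
    using maximalideal_clopen_indicator_empty[OF M] by (simp add: \<V>_def chi_def pre_def)
  have ex: "\<Inter>(\<V> M) \<noteq> {}" if M: "maximalideal M ?R" for M
  proof -
    have "\<Inter>\<F> \<noteq> {}" if "finite \<F> \<and> \<F> \<subseteq> \<V> M" for \<F>
    proof
      assume "\<Inter>\<F> = {}"
      then show False
        using Inter_mem[OF M, of \<F>] that empty[OF M] by simp
    qed
    moreover have "closedin Y V" if "V \<in> \<V> M" for V
      using that by (simp add: \<V>_def)
    ultimately have "(\<forall>V\<in>\<V> M. closedin Y V) \<and> (\<forall>\<F>. finite \<F> \<and> \<F> \<subseteq> \<V> M \<longrightarrow> \<Inter>\<F> \<noteq> {})"
      by (intro conjI ballI allI impI)
    then show ?thesis
      by (rule Y(1)[unfolded compact_space_fip, THEN spec, THEN mp])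
  qed
  define g where "g M = (SOME y. y \<in> \<Inter>(\<V> M))" for M
  have g: "g M \<in> \<Inter>(\<V> M)" if "maximalideal M ?R" for M
    unfolding g_def some_in_eq by (rule ex[OF that])
  have g_iff: "g M \<in> V \<longleftrightarrow> chi V \<notin> M"
    if M: "maximalideal M ?R" and V: "openin Y V" "closedin Y V" for M V
  proof
    show "g M \<in> V" if "chi V \<notin> M"
      using g[OF M] that V by (auto simp: \<V>_def)
    show "chi V \<notin> M" if "g M \<in> V"
    proof
      assume "chi V \<in> M"
      then have "chi (topspace Y - V) \<notin> M"
        using chi_Compl[OF M V] by simp
      then have "topspace Y - V \<in> \<V> M"
        using V by (auto simp: \<V>_def intro: closedin_diff)
      then show False
        using g[OF M] that by blast
    qed
  qed
  have "continuous_map (structure_space ?R) Y g"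
  proof (rule continuous_map_into_topology_base)
    show "openin Y = arbitrary union_of (\<lambda>V. openin Y V \<and> closedin Y V)"
      unfolding openin_topology_base_unique
    proof (intro conjI allI impI)
      fix U y
      assume "openin Y U \<and> y \<in> U"
      then obtain V where "openin Y V" "closedin Y V" "y \<in> V" "V \<subseteq> U"
        using zero_dimensional_space_clopen_neighbourhood[OF Y(3)] by metis
      then show "\<exists>V. (openin Y V \<and> closedin Y V) \<and> y \<in> V \<and> V \<subseteq> U"
        by blast
    qed blast
    show "g M \<in> topspace Y" if "M \<in> topspace (structure_space ?R)" for M
      using g Y_mem that by (auto simp: topspace_structure_space maximal_ideals_def)
    fix V
    assume V: "openin Y V \<and> closedin Y V"
    then have "{M \<in> topspace (structure_space ?R). g M \<in> V} = maximal_ideals_off ?R (chi V)"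
      using g_iff by (auto simp: topspace_structure_space maximal_ideals_def maximal_ideals_at_def)
    also have "openin (structure_space ?R) \<dots>"
      using V pre by (intro openin_maximal_ideals_off) (auto simp: chi_def intro: clopen_indicator_carrier)
    finally show "openin (structure_space ?R) {M \<in> topspace (structure_space ?R). g M \<in> V}" .
  qed
  moreover have "g (vanishing_ideal X x) = f x" if x: "x \<in> topspace X" for x
  proof (rule ccontr)
    let ?M = "vanishing_ideal X x :: ('a \<Rightarrow> 'f) set"
    assume ne: "g ?M \<noteq> f x"
    have M: "maximalideal ?M ?R"
      by (rule maximalideal_vanishing_ideal[OF x])
    have "g ?M \<in> topspace Y"
      using g[OF M] Y_mem[OF M] by blast
    then obtain U where U: "openin Y U" "g ?M \<in> U" "f x \<notin> U"
      using Y(2) pre_f[OF x] ne unfolding Hausdorff_space_def disjnt_iff by metis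
    obtain V where V: "openin Y V" "closedin Y V" "g ?M \<in> V" "V \<subseteq> U"
      using zero_dimensional_space_clopen_neighbourhood[OF Y(3) U(1,2)] .
    then have "chi V \<notin> ?M"
      using g_iff[OF M V(1,2)] by simp
    then have "x \<in> pre V"
      using clopen_indicator_in_vanishing_ideal[OF x pre[OF V(1,2)], where 'f = 'f]
      by (simp add: chi_def)
    then show False
      using U(3) V(4) by (auto simp: pre_def)
  qed
  ultimately show thesis
    by (rule that)
qed

section \<open>The Banaschewski compactification\<close>
lemma banaschewski_compactification_structure_space:
  fixes X :: "'a topology"
  assumes "Hausdorff_space X" "zero_dimensional_space X"
    and ex: "exchange_ring (countable_range_ring X :: ('a \<Rightarrow> 'f::{linordered_field, linorder_topology}) ring)"
  shows "banaschewski_compactification TYPE('y) X (vanishing_ideal X)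
           (structure_space (countable_range_ring X :: ('a \<Rightarrow> 'f) ring))"
  unfolding banaschewski_compactification_def
proof (intro conjI allI impI)
  show "compactification X (vanishing_ideal X) (structure_space (countable_range_ring X :: ('a \<Rightarrow> 'f) ring))"
    using assms by (rule compactification_structure_space)
  show "zero_dimensional_space (structure_space (countable_range_ring X :: ('a \<Rightarrow> 'f) ring))"
    using cring_countable_range_ring ex by (rule cring.exchange_ring_zero_dimensional)
  fix Y :: "'y topology" and f
  assume asm: "compact_space Y \<and> Hausdorff_space Y \<and> zero_dimensional_space Y \<and> continuous_map X Y f"
  then show "\<exists>g. continuous_map (structure_space (countable_range_ring X :: ('a \<Rightarrow> 'f) ring)) Y g \<and>
      (\<forall>x\<in>topspace X. g (vanishing_ideal X x) = f x)"
    using structure_space_extension[of Y X f] by metis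
qed

text \<open>
  Each of the two embeddings extends over the other compactification. This needs the extension
  property of \<open>K\<close> only for test spaces with the points of \<open>L\<close>, and vice versa.
\<close>
lemma banaschewski_compactification_unique:
  fixes K :: "'k topology" and L :: "'l topology"
  assumes K: "banaschewski_compactification TYPE('l) X e K"
    and L: "banaschewski_compactification TYPE('k) X d L"
  shows "compactification_equivalent X e K d L"
proof -
  have K': "compactification X e K" "zero_dimensional_space K"
    and L': "compactification X d L" "zero_dimensional_space L"
    using K L by (simp_all add: banaschewski_compactification_def)
  then have "continuous_map X K e" "continuous_map X L d"
    by (auto simp: compactification_def embedding_map_def homeomorphic_imp_continuous_map
        dest!: homeomorphic_imp_continuous_map intro: continuous_map_into_fulltopology)
  then obtain g h where "continuous_map K L g" "\<forall>x\<in>topspace X. g (e x) = d x"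
    and "continuous_map L K h" "\<forall>x\<in>topspace X. h (d x) = e x"
    using K L K' L' unfolding banaschewski_compactification_def compactification_def by metis
  then show ?thesis
    using K'(1) L'(1) by (intro compactification_equivalentI) auto
qed

theorem theorem2p18:
  fixes X :: "'a topology"
    and \<psi> :: "'a \<Rightarrow> ('a \<Rightarrow> 'f::{linordered_field, linorder_topology}) set"
    and \<M> :: "('a \<Rightarrow> 'f) set topology"
  assumes "Hausdorff_space X" and "zero_dimensional_space X"
    and "uncountable (UNIV :: 'f set) \<or>
         (countable (UNIV :: 'f set) \<and> ordered_subfield_of_reals TYPE('f))"
    and "\<psi> = vanishing_ideal X"
    and "\<M> = structure_space (countable_range_ring X)"
  shows "zero_dimensional_space \<M> \<and>
         banaschewski_compactification TYPE('y) X \<psi> \<M> \<and>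
         (\<forall>(K :: 'k topology) e.
            banaschewski_compactification TYPE(('a \<Rightarrow> 'f) set) X e K \<longrightarrow>
            compactification_equivalent X \<psi> \<M> e K)"
proof (intro conjI allI impI)
  have ex: "exchange_ring (countable_range_ring X :: ('a \<Rightarrow> 'f) ring)"
    using assms(3) by (rule exchange_ring_countable_range_ring)
  show "zero_dimensional_space \<M>"
    unfolding assms(5) using cring_countable_range_ring ex by (rule cring.exchange_ring_zero_dimensional)
  show "banaschewski_compactification TYPE('y) X \<psi> \<M>"
    unfolding assms(4,5) using assms(1,2) ex by (rule banaschewski_compactification_structure_space)
  fix K :: "'k topology" and e
  assume K: "banaschewski_compactification TYPE(('a \<Rightarrow> 'f) set) X e K"
  have "banaschewski_compactification TYPE('k) X \<psi> \<M>"
    unfolding assms(4,5) using assms(1,2) ex by (rule banaschewski_compactification_structure_space)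
  then show "compactification_equivalent X \<psi> \<M> e K"
    using K by (rule banaschewski_compactification_unique)
qed

end
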